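(* For any prime $p$, there exist elements $x,x',y\in P_{p,4}$ such that $$\langle x,y\rangle=\langle x',y\rangle\quad\text{and}\quad \operatorname{ord}([y,x'])=p\neq p^2=\operatorname{ord}([y,x]).$$ In particular, the $p$-group $H_p:=\langle x,y\rangle$ does not have property $(\mathcal{C})$.
   Context: Write $[x,y]=x^{-1}y^{-1}xy$. A finite group $G$ that can be generated by two elements has property $(\mathcal{C})$ if there is a natural number $n$ such that for all $x,y\in G$ with $\langle x,y\rangle=G$ the order of $[x,y]$ equals $n$. For a prime $p$ and $r\ge 0$, $P_{p,r}$ is the subgroup of the symmetric group $S_{p^r}$ on $\{1,\dots,p^r\}$ generated by the elements $e_{i,j}$, $1\le i\le r$, $1\le j\le p^{i-1}$, where $$e_{i,j}=\prod_{k=p^{r+1-i}(j-1)+1}^{p^{r+1-i}(j-1)+p^{r-i}}\bigl(k,\;k+p^{r-i},\;\dots,\;k+p^{r-i}(p-1)\bigr)$$ is a product of disjoint $p$-cycles. ($P_{p,r}$ is a Sylow $p$-subgroup of $S_{p^r}$.) *)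

theory Defs
  imports "HOL-Algebra.Sym_Groups" "HOL-Algebra.Multiplicative_Group" "HOL-Computational_Algebra.Primes"
begin

definition comm :: "('a, 'b) monoid_scheme \<Rightarrow> 'a \<Rightarrow> 'a \<Rightarrow> 'a" where
  "comm G x y = inv\<^bsub>G\<^esub> x \<otimes>\<^bsub>G\<^esub> inv\<^bsub>G\<^esub> y \<otimes>\<^bsub>G\<^esub> x \<otimes>\<^bsub>G\<^esub> y"

text \<open>
  Property (C), meant for finite two-generated groups.  These standing assumptions are not
  conjuncts of the definition, so that the negation of the property always speaks about
  generating pairs: if \<open>G\<close> is not generated by two elements, the property holds vacuously.
\<close>

definition property_C :: "('a, 'b) monoid_scheme \<Rightarrow> bool" where
  "property_C G \<longleftrightarrow>
     (\<exists>n::nat. \<forall>x\<in>carrier G. \<forall>y\<in>carrier G.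
        generate G {x, y} = carrier G \<longrightarrow> group.ord G (comm G x y) = n)"

text \<open>
  \<open>e_gen p r i j\<close> is the product, over all \<open>k\<close> in the stated range, of the cycles
  $(k,\, k + p^{r-i},\, \dots,\, k + p^{r-i}(p-1))$.  These cycles are disjoint,
  so the order of composition is immaterial.
\<close>

definition e_gen :: "nat \<Rightarrow> nat \<Rightarrow> nat \<Rightarrow> nat \<Rightarrow> nat \<Rightarrow> nat" where
  "e_gen p r i j =
     foldr (\<circ>)
       (map (\<lambda>k. cycle_of_list (map (\<lambda>t. k + p ^ (r - i) * t) [0..<p]))
          [p ^ (r + 1 - i) * (j - 1) + 1 ..< p ^ (r + 1 - i) * (j - 1) + p ^ (r - i) + 1])
       id"

text \<open>
  The subgroup \<open>P_syl p r\<close> of the symmetric group on \<open>{1..p ^ r}\<close>.  Products in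
  \<open>sym_group\<close> are compositions of functions, read from right to left.  The opposite
  convention gives the same generated subgroups, and it changes a commutator only up to
  inversion and conjugation, hence not its order.
\<close>

definition P_syl :: "nat \<Rightarrow> nat \<Rightarrow> (nat \<Rightarrow> nat) set" where
  "P_syl p r = generate (sym_group (p ^ r))
     {e_gen p r i j | i j. 1 \<le> i \<and> i \<le> r \<and> 1 \<le> j \<and> j \<le> p ^ (i - 1)}"

end

theory Submission
  imports Defs "HOL-Algebra.Sylow"
begin

text \<open>
  Read the points $1,\dots,p^4$ as strings of four base-$p$ digits $d_1 d_2 d_3 d_4$.  The
  generator $e_{i,j}$ advances the digit $d_i$ on exactly those strings whose first $i-1$ digits
  spell $j-1$, so $P_{p,4}$ consists of maps that change a digit only by an amount depending on
  the digits before it.  The elements are $x = x_1$ and $x' = x_0$, where $x_k$ advances $d_3$ on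
  the strings with $d_1 = 0$, $d_2 = k$ and then advances $d_1$ everywhere.  The element $y$
  advances $d_2$ where $d_1 = 0$ and afterwards, for every $d_1$, advances $d_4$ where $d_2 = 1$
  and $d_3 = 0$.

  Orders.  Let $t$ advance $d_2$, let $v$ advance $d_4$ where $d_2 = 1$, $d_3 = 0$, and let $g_k$
  advance $d_3$ where $d_2 = k$.  The commutator $[x_k,y] = [y,x_k]^{-1}$ preserves $d_1$.  It is
  $[g_k,v]\,t$ on the strings with $d_1 = 0$, it is $t^{-1}$ on those with $d_1 = p-1$, and it is
  trivial on the others.  For $k = 0$ the factors $g_0$ and $v$ act at different values of $d_2$
  and commute; what remains is $t$, of order $p$.  For $k = 1$ the factor $[g_1,v]$ is a
  nontrivial element of order $p$ concentrated at $d_2 = 1$.  Going once around the $p$ values of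
  $d_2$ meets it exactly once, so the $p$-th power of $[g_1,v]\,t$ is a copy of it at each value
  of $d_2$, and the order is $p^2$ (lemmas \<open>xy_comm_eq\<close>, \<open>xy_comm0_pow\<close>, \<open>xy_comm1_pow\<close>).

  Generation.  The same principle gives that $R_k = x_k^p$ is $g_k$ for every $d_1$, and that
  $y^p$ advances $d_4$ where $d_1 = d_3 = 0$.  Put $z = y^{-p} y$.  Where $d_1 = 0$, dividing by $y^p$
  removes the effect of $y$ on $d_4$ at $d_2 = 1$.  Hence conjugation by $z$ turns $g_0$ into $g_1$
  where $d_1 = 0$, and it fixes $g_0$ elsewhere since $v$ commutes with $g_0$.  So $z R_0 z^{-1} R_0^{-1} = x_0^{-1} x_1$, and
  $x_1 \in \langle x_0, y\rangle$.  In the converse direction $v$ does not commute with $g_1$, and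
  $y$ has to be corrected for all values of $d_1$ and not just for $d_1 = 0$.  The element $T$ that
  does so, which advances $d_4$ where $d_3 = 0$, lies in $\langle x_1, y\rangle$ because
  $(x_1 y^p)^p = R_1 T$ (lemmas \<open>x1_in_subgroup\<close>, \<open>x0_in_subgroup\<close>).

  Finally, the maps that respect the digit structure have exponent dividing $p^4$, by induction on the
  number of digits, so $\langle x, y\rangle$ is a $p$-group by Sylow's theorem.
\<close>

section \<open>Rotations of a digit and fibrewise maps\<close>

text \<open>
  The values \<open>d \<ge> p\<close> are no digits; fixing them makes \<open>rot p\<close> a permutation of all natural
  numbers, so that identities between the maps below need no side conditions on digits.
\<close>

definition rot :: "nat \<Rightarrow> nat \<Rightarrow> nat" where
  "rot p d = (if Suc d < p then Suc d else if Suc d = p then 0 else d)"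

definition turn :: "nat \<Rightarrow> nat \<times> 'w \<Rightarrow> nat \<times> 'w" where
  "turn p = (\<lambda>(d, w). (rot p d, w))"

definition fiber :: "('d \<Rightarrow> 'w \<Rightarrow> 'w) \<Rightarrow> 'd \<times> 'w \<Rightarrow> 'd \<times> 'w" where
  "fiber h = (\<lambda>(d, w). (d, h d w))"

definition only :: "nat \<Rightarrow> ('w \<Rightarrow> 'w) \<Rightarrow> nat \<times> 'w \<Rightarrow> nat \<times> 'w" where
  "only k h = fiber (\<lambda>d. if d = k then h else id)"

text \<open>
  The identity is put over the values \<open>d \<ge> p\<close> because a turn does not move them; this
  makes \<open>turn_only_funpow\<close> an equation of functions.
\<close>

definition split_at_0 :: "nat \<Rightarrow> ('w \<Rightarrow> 'w) \<Rightarrow> ('w \<Rightarrow> 'w) \<Rightarrow> nat \<times> 'w \<Rightarrow> nat \<times> 'w" where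
  "split_at_0 p h k = fiber (\<lambda>d. if d = 0 then h else if d < p then k else id)"

abbreviation every :: "nat \<Rightarrow> ('w \<Rightarrow> 'w) \<Rightarrow> nat \<times> 'w \<Rightarrow> nat \<times> 'w" where
  "every p h \<equiv> split_at_0 p h h"

lemma fiber_apply [simp]: "fiber h (d, w) = (d, h d w)"
  by (simp add: fiber_def)

lemma turn_apply [simp]: "turn p (d, w) = (rot p d, w)"
  by (simp add: turn_def)

lemma fiber_comp: "fiber h \<circ> fiber k = fiber (\<lambda>d. h d \<circ> k d)"
  by (auto simp: fiber_def)

lemma fiber_id: "fiber (\<lambda>_. id) = id"
  by (auto simp: fiber_def)

lemma fiber_funpow: "fiber h ^^ n = fiber (\<lambda>d. h d ^^ n)"
  by (induction n) (auto simp: fiber_def)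

lemma only_comp: "only k h \<circ> only k h' = only k (h \<circ> h')"
  unfolding only_def fiber_comp by (rule arg_cong[of _ _ fiber]) auto

lemma split_at_0_comp:
  "split_at_0 p h k \<circ> split_at_0 p h' k' = split_at_0 p (h \<circ> h') (k \<circ> k')"
  unfolding split_at_0_def fiber_comp by (rule arg_cong[of _ _ fiber]) auto

lemma split_at_0_funpow: "split_at_0 p h k ^^ n = split_at_0 p (h ^^ n) (k ^^ n)"
  unfolding split_at_0_def fiber_funpow by (rule arg_cong[of _ _ fiber]) auto

lemma only_funpow: "only k h ^^ n = only k (h ^^ n)"
  unfolding only_def fiber_funpow by (rule arg_cong[of _ _ fiber]) auto

lemma split_at_0_id: "split_at_0 p id id = id"
  by (auto simp: split_at_0_def)

lemma only_id: "only k id = id"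
  by (auto simp: only_def)

text \<open>
  Each of the \<open>p\<close> digits passes through \<open>0\<close> exactly once in \<open>p\<close> turns, so the map \<open>h\<close>
  placed over the single digit \<open>0\<close> is applied exactly once over every digit.  All orders and
  all \<open>p\<close>-th powers below come from this fact.
\<close>

lemma turn_only_funpow:
  assumes "2 \<le> p"
  shows "(turn p \<circ> only 0 h) ^^ p = every p h"
proof -
  define F where "F = turn p \<circ> only 0 h"
  have climb: "(F ^^ n) (d, w) = (if d + n = p then 0 else d + n, w)"
    if "0 < d" "d + n \<le> p" "d < p" for n d w
    using that by (induction n) (auto simp: F_def only_def rot_def)
  have start: "(F ^^ n) (0, w) = (if n = p then 0 else n, h w)" if "0 < n" "n \<le> p" for n w
  proof -
    from \<open>0 < n\<close> obtain m where m: "n = Suc m"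
      using gr0_implies_Suc by blast
    have "(F ^^ n) (0, w) = (F ^^ m) (F (0, w))"
      unfolding m funpow_Suc_right by simp
    also have "F (0, w) = (1, h w)"
      using assms by (simp add: F_def only_def rot_def)
    finally show ?thesis
      using climb[of 1 m "h w"] that assms by (simp add: m)
  qed
  have stay: "(F ^^ n) (d, w) = (d, w)" if "p \<le> d" for n d w
    using that assms by (induction n) (auto simp: F_def only_def rot_def)
  have "(F ^^ p) (d, w) = every p h (d, w)" for d w
  proof -
    consider "d = 0" | "0 < d" "d < p" | "p \<le> d"
      by linarith
    then show ?thesis
    proof cases
      case 1
      then show ?thesis
        using start[of p w] assms by (simp add: split_at_0_def)
    next
      case 2
      have "F ^^ p = F ^^ d \<circ> F ^^ (p - d)"
        using 2 by (simp flip: funpow_add)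
      then show ?thesis
        using 2 climb[of d "p - d" w] start[of d w] by (simp add: split_at_0_def)
    next
      case 3
      then show ?thesis
        using stay assms by (simp add: split_at_0_def)
    qed
  qed
  then show ?thesis
    unfolding F_def by auto
qed

lemma turn_funpow: "turn p ^^ n = (\<lambda>(d, w). ((rot p ^^ n) d, w))"
  by (induction n) auto

lemma turn_funpow_p:
  assumes "2 \<le> p"
  shows "turn p ^^ p = id"
  using turn_only_funpow[OF assms, of id] by (simp add: only_id split_at_0_id)

lemma rot_funpow_p:
  assumes "2 \<le> p"
  shows "rot p ^^ p = id"
proof
  fix d
  show "(rot p ^^ p) d = id d"
    using fun_cong[OF turn_funpow_p[OF assms], of "(d, ())"] by (simp add: turn_funpow)
qed

lemma rot_lt: "d < p \<Longrightarrow> rot p d < p"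
  by (auto simp: rot_def)

section \<open>Iterated wreath products of rotations\<close>

text \<open>
  Closure under inverses need not be postulated: for \<open>n > 0\<close> the inverse of \<open>f\<close> is
  \<open>f ^^ (n - 1)\<close>.
\<close>

definition torsion_monoid :: "nat \<Rightarrow> 'w set \<Rightarrow> ('w \<Rightarrow> 'w) set \<Rightarrow> bool" where
  "torsion_monoid n D W \<longleftrightarrow> id \<in> W \<and> (\<forall>f\<in>W. \<forall>g\<in>W. f \<circ> g \<in> W) \<and>
     (\<forall>f\<in>W. f ^^ n = id \<and> f ` D \<subseteq> D)"

definition wreath :: "nat \<Rightarrow> ('w \<Rightarrow> 'w) set \<Rightarrow> (nat \<times> 'w \<Rightarrow> nat \<times> 'w) set" where
  "wreath p W = {turn p ^^ c \<circ> fiber h | c h. \<forall>d. h d \<in> W}"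

lemma wreathI: "\<forall>d. h d \<in> W \<Longrightarrow> turn p ^^ c \<circ> fiber h \<in> wreath p W"
  unfolding wreath_def by blast

lemma torsion_monoid_funpow: "torsion_monoid n D W \<Longrightarrow> f \<in> W \<Longrightarrow> f ^^ k \<in> W"
  by (induction k) (auto simp: torsion_monoid_def)

lemma torsion_monoid_rot:
  assumes "2 \<le> p"
  shows "torsion_monoid p {..<p} (range (\<lambda>c. rot p ^^ c))"
proof -
  have "(rot p ^^ c) d < p" if "d < p" for c d
    using that by (induction c) (auto simp: rot_lt)
  moreover have "(rot p ^^ c) ^^ p = id" for c
    using rot_funpow_p[OF assms] by (metis funpow_mult id_funpow mult.commute)
  ultimately show ?thesis
    unfolding torsion_monoid_def
    by (auto simp flip: funpow_add intro: range_eqI[of _ _ 0])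
qed

text \<open>
  The \<open>p\<close>-th power of an element of the wreath product has trivial rotation part, hence acts
  fibrewise through elements of \<open>W\<close>, and these have exponent \<open>n\<close>.
\<close>

lemma torsion_monoid_wreath:
  assumes W: "torsion_monoid n D W" and p: "2 \<le> p"
  shows "torsion_monoid (p * n) ({..<p} \<times> D) (wreath p W)"
  unfolding torsion_monoid_def
proof (intro conjI ballI)
  have W_id: "id \<in> W" and W_comp: "\<And>f g. f \<in> W \<Longrightarrow> g \<in> W \<Longrightarrow> f \<circ> g \<in> W"
    and W_pow: "\<And>f. f \<in> W \<Longrightarrow> f ^^ n = id" and W_D: "\<And>f. f \<in> W \<Longrightarrow> f ` D \<subseteq> D"
    using W by (auto simp: torsion_monoid_def)
  have rot_pow_lt: "(rot p ^^ c) d < p" if "d < p" for c d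
    using that by (induction c) (auto simp: rot_lt)
  have "id = turn p ^^ 0 \<circ> fiber (\<lambda>_. id)"
    by (simp add: fiber_id)
  then show "id \<in> wreath p W"
    using W_id wreathI by metis
  have mult: "(turn p ^^ c \<circ> fiber h) \<circ> (turn p ^^ c' \<circ> fiber h') =
      turn p ^^ (c + c') \<circ> fiber (\<lambda>d. h ((rot p ^^ c') d) \<circ> h' d)" for c c' and h h' :: "nat \<Rightarrow> 'a \<Rightarrow> 'a"
    by (auto simp: turn_funpow funpow_add)
  show "f \<circ> g \<in> wreath p W" if fg: "f \<in> wreath p W" "g \<in> wreath p W" for f g
  proof -
    obtain c h c' h' where f: "f = turn p ^^ c \<circ> fiber h" and g: "g = turn p ^^ c' \<circ> fiber h'"
      and h: "\<forall>d. h d \<in> W" "\<forall>d. h' d \<in> W"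
      using fg unfolding wreath_def by blast
    have "\<forall>d. h ((rot p ^^ c') d) \<circ> h' d \<in> W"
      using h by (intro allI W_comp) blast+
    then show ?thesis
      unfolding f g mult by (rule wreathI)
  qed
  fix f assume "f \<in> wreath p W"
  then obtain c h where f: "f = turn p ^^ c \<circ> fiber h" and h: "\<forall>d. h d \<in> W"
    unfolding wreath_def by blast
  show "f ` ({..<p} \<times> D) \<subseteq> {..<p} \<times> D"
    using W_D h rot_pow_lt unfolding f by (fastforce simp: turn_funpow)
  have "\<exists>h'. (\<forall>d. h' d \<in> W) \<and> f ^^ m = turn p ^^ (c * m) \<circ> fiber h'" for m
  proof (induction m)
    case 0
    show ?case
      using W_id by (intro exI[of _ "\<lambda>_. id"]) (auto simp: fun_eq_iff id_def)
  next
    case (Suc m)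
    then obtain h' where h': "\<forall>d. h' d \<in> W" "f ^^ m = turn p ^^ (c * m) \<circ> fiber h'"
      by blast
    then have "f ^^ Suc m = (turn p ^^ c \<circ> fiber h) \<circ> (turn p ^^ (c * m) \<circ> fiber h')"
      by (simp add: f)
    then have "f ^^ Suc m = turn p ^^ (c * Suc m) \<circ> fiber (\<lambda>d. h ((rot p ^^ (c * m)) d) \<circ> h' d)"
      unfolding mult by simp
    moreover have "\<forall>d. h ((rot p ^^ (c * m)) d) \<circ> h' d \<in> W"
      using h h'(1) by (intro allI W_comp) blast+
    ultimately show ?case
      by (intro exI conjI)
  qed
  then obtain h' where h': "\<forall>d. h' d \<in> W" "f ^^ p = turn p ^^ (c * p) \<circ> fiber h'"
    by blast
  have "turn p ^^ (c * p) = (id :: nat \<times> 'a \<Rightarrow> _)"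
    using turn_funpow_p[OF p] by (metis funpow_mult id_funpow mult.commute)
  then have "f ^^ p = fiber h'"
    using h' by simp
  then have "f ^^ (p * n) = fiber (\<lambda>d. h' d ^^ n)"
    by (metis funpow_mult fiber_funpow mult.commute)
  then show "f ^^ (p * n) = id"
    using h'(1) W_pow by (simp add: fiber_id)
qed

lemma wreath_fiber: "(\<And>d. h d \<in> W) \<Longrightarrow> fiber h \<in> wreath p W"
  using wreathI[of h W 0 p] by simp

lemma wreath_turn: "id \<in> W \<Longrightarrow> turn p \<in> wreath p W"
  using wreathI[of "\<lambda>_. id" W 1 p] by (simp add: fiber_id)

section \<open>The elements and their relations\<close>

text \<open>
  The shape of a commutator of a turn, possibly modified over the digit \<open>0\<close>, with a fibrewise
  map that is the same over all digits except \<open>0\<close>: neighbouring fibres cancel except on the two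
  sides of \<open>0\<close>.
\<close>

definition ends :: "nat \<Rightarrow> ('w \<Rightarrow> 'w) \<Rightarrow> ('w \<Rightarrow> 'w) \<Rightarrow> nat \<times> 'w \<Rightarrow> nat \<times> 'w" where
  "ends p a b = fiber (\<lambda>d. if d = 0 then a else if Suc d = p then b else id)"

lemma ends_funpow: "ends p a b ^^ n = ends p (a ^^ n) (b ^^ n)"
  unfolding ends_def fiber_funpow by (rule arg_cong[of _ _ fiber]) auto

lemma ends_id: "ends p id id = id"
  by (auto simp: ends_def)

text \<open>
  The equation \<open>y x c = x y\<close> says \<open>c = [x, y]\<close>; written this way it involves no inverses.  The
  hypotheses are its components over the digits \<open>0\<close> and \<open>p - 1\<close>; over the other digits both
  sides act by \<open>v\<close>.
\<close>

lemma ends_solves_commutator: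
  assumes p: "2 \<le> p" and a: "v \<circ> g \<circ> a = g \<circ> u" and b: "u \<circ> b = v"
  shows "split_at_0 p u v \<circ> (turn p \<circ> only 0 g) \<circ> ends p a b
       = turn p \<circ> only 0 g \<circ> split_at_0 p u v"
proof
  fix z :: "nat \<times> 'a"
  obtain d w where z: "z = (d, w)"
    by fastforce
  show "(split_at_0 p u v \<circ> (turn p \<circ> only 0 g) \<circ> ends p a b) z =
      (turn p \<circ> only 0 g \<circ> split_at_0 p u v) z"
    using p fun_cong[OF a, of w] fun_cong[OF b, of w]
    by (auto simp: z ends_def split_at_0_def only_def rot_def)
qed

lemma only_1_turn_funpow:
  assumes "2 \<le> p"
  shows "(only 1 h \<circ> turn p) ^^ p = every p h"
proof -
  have "only 1 h \<circ> turn p = turn p \<circ> only 0 h"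
    using assms by (auto simp: only_def rot_def)
  then show ?thesis
    using turn_only_funpow[OF assms] by simp
qed

lemma only_swap: "i \<noteq> j \<Longrightarrow> only i h \<circ> only j k = only j k \<circ> only i h"
  by (auto simp: only_def)

text \<open>
  The factor \<open>every p s'\<close> undoes \<open>s\<close> over the digit \<open>1\<close>, which is where the turn puts what was over
  \<open>0\<close>.  Without it \<open>r\<close> would arrive conjugated by \<open>s\<close>.
\<close>

lemma cleared_shift_only:
  assumes "2 \<le> p" and "s' \<circ> s = id"
  shows "(every p s' \<circ> (only 1 s \<circ> turn p)) \<circ> only 0 r = only 1 r \<circ> (every p s' \<circ> (only 1 s \<circ> turn p))"
  using assms by (auto simp: fun_eq_iff only_def split_at_0_def rot_def)

lemma cleared_mark_only:
  assumes "2 \<le> p" and "s' \<circ> s = id"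
  shows "(every p s' \<circ> only 1 s) \<circ> only 1 r = only 1 r \<circ> (every p s' \<circ> only 1 s)"
  using assms by (auto simp: fun_eq_iff only_def split_at_0_def)

text \<open>
  These act on the last two digits $(d_3, d_4)$ or on the last three digits $(d_2, d_3, d_4)$.
  In the notation of the introduction, \<open>slot p k\<close> is $g_k$, \<open>mark p\<close> is $v$, and \<open>shift p\<close> is the
  restriction of $y$ to $d_1 = 0$.
\<close>

definition nudge :: "nat \<Rightarrow> nat \<times> nat \<Rightarrow> nat \<times> nat" where
  "nudge p = only 0 (rot p)"

definition unnudge :: "nat \<Rightarrow> nat \<times> nat \<Rightarrow> nat \<times> nat" where
  "unnudge p = only 0 (rot p ^^ (p - 1))"

definition slot :: "nat \<Rightarrow> nat \<Rightarrow> nat \<times> nat \<times> nat \<Rightarrow> nat \<times> nat \<times> nat" where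
  "slot p k = only k (turn p)"

definition mark :: "nat \<Rightarrow> nat \<times> nat \<times> nat \<Rightarrow> nat \<times> nat \<times> nat" where
  "mark p = only 1 (nudge p)"

definition shift :: "nat \<Rightarrow> nat \<times> nat \<times> nat \<Rightarrow> nat \<times> nat \<times> nat" where
  "shift p = mark p \<circ> turn p"

type_synonym digits = "nat \<times> nat \<times> nat \<times> nat"

definition x_elem :: "nat \<Rightarrow> nat \<Rightarrow> digits \<Rightarrow> digits" where
  "x_elem p k = turn p \<circ> only 0 (slot p k)"

definition y_elem :: "nat \<Rightarrow> digits \<Rightarrow> digits" where
  "y_elem p = split_at_0 p (shift p) (mark p)"

text \<open>
  This is the commutator $[r, s]$ of $r$, the turn of $d_3$, with $s$, the nudge.
\<close>

definition nudge_comm :: "nat \<Rightarrow> nat \<times> nat \<Rightarrow> nat \<times> nat" where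
  "nudge_comm p = ends p (rot p) (rot p ^^ (p - 1))"

text \<open>
  This is the commutator of \<open>x_elem p k\<close> with \<open>y_elem p\<close>, for \<open>k = 0\<close> and \<open>k = 1\<close>.
\<close>

definition xy_comm :: "nat \<Rightarrow> nat \<Rightarrow> digits \<Rightarrow> digits" where
  "xy_comm p k = ends p (if k = 0 then turn p else only 1 (nudge_comm p) \<circ> turn p) (turn p ^^ (p - 1))"

context
  fixes p :: nat
  assumes p: "2 \<le> p"
begin

lemma pred_inverse:
  assumes "f ^^ p = id"
  shows "f \<circ> f ^^ (p - 1) = id" "f ^^ (p - 1) \<circ> f = id"
  using assms p by (metis Suc_diff_1 funpow.simps(2) less_le_trans zero_less_numeral,
      metis Suc_diff_1 funpow_Suc_right less_le_trans zero_less_numeral)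

lemma unnudge_nudge: "unnudge p \<circ> nudge p = id" and nudge_unnudge: "nudge p \<circ> unnudge p = id"
  unfolding unnudge_def nudge_def only_comp
  using pred_inverse[OF rot_funpow_p[OF p]] by (simp_all add: only_id)

lemma nudge_pow: "nudge p ^^ p = id"
  by (simp add: nudge_def only_funpow rot_funpow_p[OF p] only_id)

lemma mark_pow: "mark p ^^ p = id"
  by (simp add: mark_def only_funpow nudge_pow only_id)

lemma shift_pow: "shift p ^^ p = every p (nudge p)"
  unfolding shift_def mark_def by (rule only_1_turn_funpow[OF p])

lemma x_elem_pow: "x_elem p k ^^ p = every p (slot p k)"
  unfolding x_elem_def by (rule turn_only_funpow[OF p])

lemma y_elem_pow: "y_elem p ^^ p = split_at_0 p (every p (nudge p)) id"
  by (simp add: y_elem_def split_at_0_funpow shift_pow mark_pow)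

text \<open>
  Since \<open>S\<close> sits over the same digit \<open>0\<close> as \<open>slot p k\<close>, one full tour spreads both of them
  together.  With \<open>x_elem_pow\<close>, this puts \<open>every p S\<close> into every group that contains the two
  factors on the left.
\<close>

lemma x_elem_y_elem_pow:
  "(x_elem p k \<circ> split_at_0 p S id) ^^ p = every p (slot p k) \<circ> every p S"
proof -
  have "x_elem p k \<circ> split_at_0 p S id = turn p \<circ> only 0 (slot p k \<circ> S)"
    using p by (auto simp: x_elem_def only_def split_at_0_def)
  then show ?thesis
    using turn_only_funpow[OF p] by (metis split_at_0_comp)
qed

lemma slot_swap: "slot p 0 \<circ> slot p 1 = slot p 1 \<circ> slot p 0"
  unfolding slot_def by (rule only_swap) simp

text \<open>
  Because \<open>slot p 0\<close> and \<open>slot p 1\<close> commute, the quotient of the two elements \<open>x_elem p 0\<close> and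
  \<open>x_elem p 1\<close> is a quotient of fibrewise maps.  The right factors are the conjugates
  computed in \<open>y_cleared_at_0_slot\<close> and \<open>y_cleared_slot\<close>.
\<close>

lemma x_elem_every:
  "x_elem p 1 \<circ> every p (slot p 0) = x_elem p 0 \<circ> split_at_0 p (slot p 1) (slot p 0)"
  "x_elem p 0 \<circ> every p (slot p 1) = x_elem p 1 \<circ> split_at_0 p (slot p 0) (slot p 1)"
  using slot_swap by (auto simp: x_elem_def only_def split_at_0_def fun_eq_iff)

text \<open>
  The element $z = y^{-p}y$, and its variant $T^{-1}y$ in which $y$ is corrected for all
  values of $d_1$.
\<close>

definition y_cleared_at_0 :: "digits \<Rightarrow> digits" where
  "y_cleared_at_0 = split_at_0 p (every p (unnudge p) \<circ> shift p) (mark p)"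

definition y_cleared :: "digits \<Rightarrow> digits" where
  "y_cleared = split_at_0 p (every p (unnudge p) \<circ> shift p) (every p (unnudge p) \<circ> mark p)"

lemma every_nudge_unnudge: "every p (nudge p) \<circ> (every p (unnudge p) \<circ> f) = f"
  unfolding comp_assoc[symmetric] split_at_0_comp nudge_unnudge split_at_0_id by simp

lemma y_cleared_at_0_y_elem: "split_at_0 p (every p (nudge p)) id \<circ> y_cleared_at_0 = y_elem p"
  by (simp add: y_cleared_at_0_def y_elem_def split_at_0_comp every_nudge_unnudge)

lemma y_cleared_y_elem: "every p (every p (nudge p)) \<circ> y_cleared = y_elem p"
  by (simp add: y_cleared_def y_elem_def split_at_0_comp every_nudge_unnudge)

lemma shift_slot: "every p (unnudge p) \<circ> shift p \<circ> slot p 0 = slot p 1 \<circ> (every p (unnudge p) \<circ> shift p)"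
  unfolding shift_def slot_def mark_def by (rule cleared_shift_only[OF p unnudge_nudge])

lemma y_cleared_at_0_slot: "y_cleared_at_0 \<circ> every p (slot p 0) = split_at_0 p (slot p 1) (slot p 0) \<circ> y_cleared_at_0"
proof -
  have "mark p \<circ> slot p 0 = slot p 0 \<circ> mark p"
    unfolding mark_def slot_def by (rule only_swap) simp
  then show ?thesis
    unfolding y_cleared_at_0_def split_at_0_comp shift_slot by simp
qed

lemma y_cleared_slot: "y_cleared \<circ> split_at_0 p (slot p 0) (slot p 1) = every p (slot p 1) \<circ> y_cleared"
proof -
  have "every p (unnudge p) \<circ> mark p \<circ> slot p 1 = slot p 1 \<circ> (every p (unnudge p) \<circ> mark p)"
    unfolding mark_def slot_def by (rule cleared_mark_only[OF p unnudge_nudge])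
  then show ?thesis
    unfolding y_cleared_def split_at_0_comp shift_slot by simp
qed

lemma nudge_comm_eq: "nudge p \<circ> turn p \<circ> nudge_comm p = turn p \<circ> nudge p"
proof -
  have "split_at_0 p (rot p) id \<circ> (turn p \<circ> only 0 id) \<circ> nudge_comm p
       = turn p \<circ> only 0 id \<circ> split_at_0 p (rot p) id"
    unfolding nudge_comm_def using pred_inverse[OF rot_funpow_p[OF p]] by (intro ends_solves_commutator[OF p]) auto
  moreover have "split_at_0 p (rot p) id = nudge p"
    by (auto simp: split_at_0_def nudge_def only_def)
  ultimately show ?thesis
    by (simp add: only_id)
qed

lemma xy_comm_eq:
  assumes "k \<le> 1"
  shows "y_elem p \<circ> x_elem p k \<circ> xy_comm p k = x_elem p k \<circ> y_elem p"
  unfolding y_elem_def x_elem_def xy_comm_def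
proof (rule ends_solves_commutator[OF p])
  show "shift p \<circ> turn p ^^ (p - 1) = mark p"
    unfolding shift_def comp_assoc pred_inverse[OF turn_funpow_p[OF p]] by simp
  show "mark p \<circ> slot p k \<circ> (if k = 0 then turn p else only 1 (nudge_comm p) \<circ> turn p) = slot p k \<circ> shift p"
  proof (cases "k = 0")
    case True
    have "mark p \<circ> slot p 0 = slot p 0 \<circ> mark p"
      unfolding mark_def slot_def by (rule only_swap) simp
    then show ?thesis
      using True by (simp add: shift_def comp_assoc)
  next
    case False
    then have "k = 1"
      using assms by simp
    moreover have "mark p \<circ> slot p 1 \<circ> only 1 (nudge_comm p) = slot p 1 \<circ> mark p"
      by (simp add: mark_def slot_def only_comp nudge_comm_eq)
    ultimately show ?thesis
      by (simp add: shift_def flip: comp_assoc)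
  qed
qed

lemma inverse_pow: "f ^^ p = id \<Longrightarrow> (f ^^ n) ^^ p = id"
  by (metis funpow_mult id_funpow mult.commute)

lemma nudge_comm_pow: "nudge_comm p ^^ p = id"
  unfolding nudge_comm_def ends_funpow
  by (simp add: inverse_pow rot_funpow_p[OF p] ends_id)

lemma xy_comm0_pow: "xy_comm p 0 ^^ p = id"
  unfolding xy_comm_def ends_funpow
  by (simp add: inverse_pow turn_funpow_p[OF p] ends_id)

lemma xy_comm1_pow: "xy_comm p 1 ^^ p = ends p (every p (nudge_comm p)) id"
  unfolding xy_comm_def ends_funpow
  by (simp add: inverse_pow turn_funpow_p[OF p] only_1_turn_funpow[OF p] del: One_nat_def)

lemma xy_comm1_pow2: "xy_comm p 1 ^^ (p ^ 2) = id"
  unfolding power2_eq_square funpow_mult[symmetric] xy_comm1_pow ends_funpow split_at_0_funpow nudge_comm_pow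
  by (simp add: split_at_0_id ends_id)

lemma xy_comm0_moves: "xy_comm p 0 (0, 0, 0, 0) = (0, 1, 0, 0)"
  using p by (simp add: xy_comm_def ends_def rot_def)

lemma xy_comm1_pow_moves: "(xy_comm p 1 ^^ p) (0, 0, 0, 0) = (0, 0, 0, 1)"
  unfolding xy_comm1_pow using p by (simp add: ends_def split_at_0_def nudge_comm_def rot_def)

end

section \<open>The generators as maps of digits\<close>

lemma foldr_comp_fixed:
  "(\<And>k. k \<in> set ks \<Longrightarrow> F k n = n) \<Longrightarrow> foldr (\<circ>) (map F ks) id n = n"
  by (induction ks) auto

lemma foldr_comp_moved:
  assumes "distinct ks" "k0 \<in> set ks" "F k0 n = m"
    and "\<And>k. k \<in> set ks \<Longrightarrow> k \<noteq> k0 \<Longrightarrow> F k n = n \<and> F k m = m"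
  shows "foldr (\<circ>) (map F ks) id n = m"
  using assms
proof (induction ks)
  case (Cons k ks)
  have step: "foldr (\<circ>) (map F (k # ks)) id n = F k (foldr (\<circ>) (map F ks) id n)"
    by (simp only: list.map foldr.simps comp_apply)
  show ?case
  proof (cases "k = k0")
    case True
    then have "foldr (\<circ>) (map F ks) id n = n"
      using Cons.prems by (intro foldr_comp_fixed) auto
    then show ?thesis
      unfolding step using True Cons.prems by simp
  next
    case False
    then have "foldr (\<circ>) (map F ks) id n = m"
      using Cons.prems by (intro Cons.IH) auto
    then show ?thesis
      unfolding step using False Cons.prems by auto
  qed
qed simp

lemma cycle_of_list_progression:
  assumes "0 < q" "t < p"
  shows "cycle_of_list (map (\<lambda>t. k + q * t) [0..<p]) (k + q * t) = k + q * rot p t"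
proof -
  define cs where "cs = map (\<lambda>t. k + q * t) [0..<p]"
  have "distinct cs"
    unfolding cs_def using assms by (auto simp: distinct_map inj_on_def)
  then have "map (cycle_of_list cs) cs = rotate1 cs"
    using cyclic_rotation[of cs 1] by simp
  then have "cycle_of_list cs (cs ! t) = rotate1 cs ! t"
    using assms by (metis cs_def diff_zero length_map length_upt nth_map)
  also have "\<dots> = cs ! (Suc t mod p)"
    using assms by (simp add: cs_def nth_rotate1)
  also have "\<dots> = k + q * rot p t"
    using assms by (cases "Suc t = p") (auto simp: cs_def rot_def)
  finally show ?thesis
    using assms by (simp add: cs_def)
qed

lemma cycle_of_list_progression_fixed:
  assumes "\<And>t. t < p \<Longrightarrow> n \<noteq> k + q * t"
  shows "cycle_of_list (map (\<lambda>t. k + q * t) [0..<p]) n = n"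
proof (rule id_outside_supp, rule notI)
  assume "n \<in> set (map (\<lambda>t. k + q * t) [0..<p])"
  then obtain t where "t < p" "n = k + q * t"
    by auto
  then show False
    using assms[of t] by blast
qed

lemma digit_append_eq_iff:
  fixes a b a' b' q :: nat
  assumes "b < q" "b' < q"
  shows "a * q + b = a' * q + b' \<longleftrightarrow> a = a' \<and> b = b'"
  using assms
  by (metis add.commute div_mult_self3 div_less mod_less mod_mult_self3 add_0 less_nat_zero_code)

lemma digit_append_less:
  fixes a b m q :: nat
  assumes "a < m" "b < q"
  shows "a * q + b < m * q"
proof -
  have "a * q + b < Suc a * q"
    using assms by simp
  also have "\<dots> \<le> m * q"
    using assms by (intro mult_le_mono1) simp
  finally show ?thesis .
qed

text \<open>
  In \<open>(P * p + t) * p ^ (r - i) + l + 1\<close> the number \<open>P\<close> encodes the first \<open>i - 1\<close> digits, \<open>t\<close> is the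
  digit in position \<open>i\<close>, and \<open>l\<close> encodes the later digits.  The cycles that make up the generator
  are indexed by \<open>l\<close>, so at most one of them moves a given point.
\<close>

lemma e_gen_apply:
  assumes "i \<le> r" "t < p" "l < p ^ (r - i)"
  shows "e_gen p r i (Suc J) ((P * p + t) * p ^ (r - i) + l + 1) =
    (if P = J then (P * p + rot p t) * p ^ (r - i) + l + 1 else (P * p + t) * p ^ (r - i) + l + 1)"
    (is "_ = ?rhs")
proof -
  define Q where "Q = p ^ (r - i)"
  define n where "n = (P * p + t) * Q + l + 1"
  define F where "F = (\<lambda>k. cycle_of_list (map (\<lambda>t. k + Q * t) [0..<p]))"
  define ks where "ks = [p * Q * J + 1 ..< p * Q * J + Q + 1]"
  have e_gen: "e_gen p r i (Suc J) = foldr (\<circ>) (map F ks) id"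
    using assms(1) by (simp add: e_gen_def F_def ks_def Q_def Suc_diff_le)
  have Q: "0 < Q" "l < Q"
    using assms by (auto simp: Q_def)
  have fixes_other: "F k ((P' * p + t') * Q + l' + 1) = (P' * p + t') * Q + l' + 1"
    if k: "k \<in> set ks" and ne: "P' \<noteq> J \<or> k \<noteq> J * p * Q + l' + 1" and lt: "t' < p" "l' < Q" for k P' t' l'
  proof -
    obtain m where m: "k = J * p * Q + m + 1" "m < Q"
      using k that[of "k - (J * p * Q + 1)"] by (auto simp: ks_def mult_ac)
    have "(P' * p + t') * Q + l' + 1 \<noteq> k + Q * s" if "s < p" for s
    proof
      assume "(P' * p + t') * Q + l' + 1 = k + Q * s"
      \<comment> \<open>A common point determines the index of the cycle, by uniqueness of base-\<open>p\<close> expansions.\<close>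
      then have "(P' * p + t') * Q + l' = (J * p + s) * Q + m"
        by (simp add: m algebra_simps)
      then have "P' * p + t' = J * p + s" "l' = m"
        using digit_append_eq_iff[OF lt(2) m(2)] by blast+
      then show False
        using digit_append_eq_iff[OF lt(1) \<open>s < p\<close>, of P' J] ne m by auto
    qed
    then show ?thesis
      unfolding F_def by (rule cycle_of_list_progression_fixed)
  qed
  show ?thesis
  proof (cases "P = J")
    case True
    define k0 where "k0 = J * p * Q + l + 1"
    have "foldr (\<circ>) (map F ks) id n = (P * p + rot p t) * Q + l + 1"
    proof (rule foldr_comp_moved)
      show "distinct ks"
        by (simp add: ks_def)
      show "k0 \<in> set ks"
        using Q by (simp add: ks_def k0_def mult_ac, linarith)
      have "n = k0 + Q * t"
        using True by (simp add: n_def k0_def algebra_simps)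
      then show "F k0 n = (P * p + rot p t) * Q + l + 1"
        unfolding F_def using cycle_of_list_progression[OF Q(1) assms(2), of k0] True
        by (simp add: k0_def algebra_simps)
      show "F k n = n \<and> F k ((P * p + rot p t) * Q + l + 1) = (P * p + rot p t) * Q + l + 1"
        if "k \<in> set ks" "k \<noteq> k0" for k
        using fixes_other that assms rot_lt[OF assms(2)] Q unfolding n_def k0_def by blast
    qed
    then show ?thesis
      using True by (simp add: e_gen n_def Q_def)
  next
    case False
    then have "foldr (\<circ>) (map F ks) id n = n"
      using fixes_other assms Q unfolding n_def by (intro foldr_comp_fixed) blast
    then show ?thesis
      using False by (simp add: e_gen n_def Q_def)
  qed
qed

lemma e_gen_outside:
  assumes "1 \<le> i" "i \<le> r" "J < p ^ (i - 1)" "n \<notin> {1..p ^ r}"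
  shows "e_gen p r i (Suc J) n = n"
  unfolding e_gen_def
proof (rule foldr_comp_fixed)
  fix k
  define Q where "Q = p ^ (r - i)"
  assume "k \<in> set [p ^ (r + 1 - i) * (Suc J - 1) + 1..<p ^ (r + 1 - i) * (Suc J - 1) + p ^ (r - i) + 1]"
  then have k: "p * Q * J + 1 \<le> k" "k < p * Q * J + Q + 1"
    using assms(2) by (auto simp: Q_def Suc_diff_le)
  have "k + Q * s \<in> {1..p ^ r}" if "s < p" for s
  proof -
    define m where "m = k - (p * Q * J + 1)"
    have "J * p + s < p ^ (i - 1) * p"
      by (rule digit_append_less[OF assms(3) that])
    then have "(J * p + s) * Q + m < p ^ (i - 1) * p * Q"
      using k by (intro digit_append_less[of "J * p + s"]) (auto simp: m_def)
    moreover have "p ^ (i - 1) * p * Q = p ^ r"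
    proof -
      have "(i - 1) + 1 + (r - i) = r"
        using assms by simp
      then show ?thesis
        unfolding Q_def by (metis power_add power_one_right)
    qed
    moreover have "k + Q * s = (J * p + s) * Q + m + 1"
      using k by (simp add: m_def algebra_simps)
    ultimately show ?thesis
      by simp
  qed
  then show "cycle_of_list (map (\<lambda>t. k + p ^ (r - i) * t) [0..<p]) n = n"
    using assms(4) unfolding Q_def by (intro cycle_of_list_progression_fixed) metis
qed

definition label :: "nat \<Rightarrow> digits \<Rightarrow> nat" where
  "label p = (\<lambda>(a, b, c, d). ((a * p + b) * p + c) * p + d + 1)"

abbreviation digits :: "nat \<Rightarrow> digits set" where
  "digits p \<equiv> {..<p} \<times> {..<p} \<times> {..<p} \<times> {..<p}"

text \<open>
  Being the identity outside \<open>{1..p ^ 4}\<close> is part of membership in the symmetric group.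
\<close>

definition relabel :: "nat \<Rightarrow> (digits \<Rightarrow> digits) \<Rightarrow> nat \<Rightarrow> nat" where
  "relabel p f n = (if n \<in> {1..p ^ 4} then label p (f (inv_into (digits p) (label p) n)) else n)"

lemma bij_betw_label: "bij_betw (label p) (digits p) {1..p ^ 4}"
proof -
  have inj: "inj_on (label p) (digits p)"
    by (auto simp: inj_on_def label_def digit_append_eq_iff)
  have "((a * p + b) * p + c) * p + d < p * p * p * p" if "a < p" "b < p" "c < p" "d < p" for a b c d
    using that by (intro digit_append_less)
  then have "label p ` digits p \<subseteq> {1..p ^ 4}"
    by (auto simp: label_def power4_eq_xxxx Suc_le_eq)
  moreover have "card (label p ` digits p) = p ^ 4"
    using inj by (simp add: card_image card_cartesian_product power4_eq_xxxx)
  ultimately show ?thesis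
    using inj by (simp add: bij_betw_def card_subset_eq)
qed

lemma label_in: "z \<in> digits p \<Longrightarrow> label p z \<in> {1..p ^ 4}"
  using bij_betw_label by (rule bij_betw_apply)

lemma relabel_label: "z \<in> digits p \<Longrightarrow> relabel p f (label p z) = label p (f z)"
  using label_in[of z p] bij_betw_label[of p] by (simp add: relabel_def bij_betw_def)

lemma relabel_outside: "n \<notin> {1..p ^ 4} \<Longrightarrow> relabel p f n = n"
  by (simp only: relabel_def if_False)

lemma relabel_eqI:
  assumes "\<And>z. z \<in> digits p \<Longrightarrow> h (label p z) = label p (f z)" and "\<And>n. n \<notin> {1..p ^ 4} \<Longrightarrow> h n = n"
  shows "h = relabel p f"
proof
  fix n
  show "h n = relabel p f n"
  proof (cases "n \<in> {1..p ^ 4}")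
    case True
    then have "n \<in> label p ` digits p"
      using bij_betw_label[of p] by (simp only: bij_betw_def)
    then obtain z where "z \<in> digits p" "n = label p z"
      by blast
    then show ?thesis
      using assms(1) by (simp add: relabel_label)
  next
    case False
    then show ?thesis
      using assms(2) by (auto simp: relabel_def)
  qed
qed

lemma relabel_comp:
  assumes "g ` digits p \<subseteq> digits p"
  shows "relabel p f \<circ> relabel p g = relabel p (f \<circ> g)"
proof (rule relabel_eqI)
  fix z assume z: "z \<in> digits p"
  have "g z \<in> digits p"
    by (rule subsetD[OF assms imageI[OF z]])
  then show "(relabel p f \<circ> relabel p g) (label p z) = label p ((f \<circ> g) z)"
    using z by (simp only: comp_apply relabel_label)
next
  show "(relabel p f \<circ> relabel p g) n = n" if "n \<notin> {1..p ^ 4}" for n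
    using relabel_outside[OF that] by simp
qed

lemma relabel_id: "relabel p id = id"
  by (rule relabel_eqI[symmetric]) auto

lemma relabel_funpow:
  assumes "f ` digits p \<subseteq> digits p"
  shows "relabel p f ^^ n = relabel p (f ^^ n)"
proof (induction n)
  case 0
  show ?case
    by (simp only: funpow.simps(1) relabel_id)
next
  case (Suc n)
  then show ?case
    by (simp only: funpow_Suc_right relabel_comp[OF assms])
qed

text \<open>
  The prefixes that occur are the empty one, $0$, $0\,k$ and $m\,1\,0$; read in base \<open>p\<close> they are
  the numbers \<open>0\<close>, \<open>0\<close>, \<open>k\<close> and \<open>(m * p + 1) * p\<close>.
\<close>

lemma e_gen_relabel:
  assumes "2 \<le> p"
  shows "e_gen p 4 1 1 = relabel p (turn p)"
    and "e_gen p 4 2 1 = relabel p (only 0 (turn p))"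
    and "k < p \<Longrightarrow> e_gen p 4 3 (Suc k) = relabel p (only 0 (only k (turn p)))"
    and "m < p \<Longrightarrow> e_gen p 4 4 (Suc ((m * p + 1) * p)) = relabel p (only m (only 1 (only 0 (rot p))))"
proof -
  show "e_gen p 4 1 1 = relabel p (turn p)"
  proof (rule relabel_eqI)
    fix z assume z: "z \<in> digits p"
    obtain a b c d where z': "z = (a, b, c, d)" "a < p" "b < p" "c < p" "d < p"
      using z by auto
    have "(b * p + c) * p + d < p * p * p"
      using z' by (intro digit_append_less)
    then show "e_gen p 4 1 1 (label p z) = label p (turn p z)"
      using e_gen_apply[of 1 4 a p "(b * p + c) * p + d" 0 0] z'
      by (simp add: label_def power3_eq_cube algebra_simps)
  next
    show "e_gen p 4 1 1 n = n" if "n \<notin> {1..p ^ 4}" for n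
      using e_gen_outside[of 1 4 0 p n] that by simp
  qed
  show "e_gen p 4 2 1 = relabel p (only 0 (turn p))"
  proof (rule relabel_eqI)
    fix z assume z: "z \<in> digits p"
    obtain a b c d where z': "z = (a, b, c, d)" "a < p" "b < p" "c < p" "d < p"
      using z by auto
    have "c * p + d < p * p"
      using z' by (intro digit_append_less)
    then show "e_gen p 4 2 1 (label p z) = label p (only 0 (turn p) z)"
      using e_gen_apply[of 2 4 b p "c * p + d" 0 a] z'
      by (simp add: label_def only_def power2_eq_square algebra_simps)
  next
    show "e_gen p 4 2 1 n = n" if "n \<notin> {1..p ^ 4}" for n
      using e_gen_outside[of 2 4 0 p n] that assms by simp
  qed
  show "e_gen p 4 3 (Suc k) = relabel p (only 0 (only k (turn p)))" if k: "k < p"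
  proof (rule relabel_eqI)
    fix z assume z: "z \<in> digits p"
    obtain a b c d where z': "z = (a, b, c, d)" "a < p" "b < p" "c < p" "d < p"
      using z by auto
    have "a * p + b = k \<longleftrightarrow> a = 0 \<and> b = k"
      using digit_append_eq_iff[of b p k a 0] z' k by simp
    then show "e_gen p 4 3 (Suc k) (label p z) = label p (only 0 (only k (turn p)) z)"
      using e_gen_apply[of 3 4 c p d k "a * p + b"] z'
      by (auto simp: label_def only_def)
  next
    have "k < p ^ (3 - 1)"
      using k power_increasing[of 1 2 p] by simp
    then show "e_gen p 4 3 (Suc k) n = n" if "n \<notin> {1..p ^ 4}" for n
      using e_gen_outside[of 3 4 k p n] that by simp
  qed
  show "e_gen p 4 4 (Suc ((m * p + 1) * p)) = relabel p (only m (only 1 (only 0 (rot p))))" if m: "m < p"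
  proof (rule relabel_eqI)
    fix z assume z: "z \<in> digits p"
    obtain a b c d where z': "z = (a, b, c, d)" "a < p" "b < p" "c < p" "d < p"
      using z by auto
    have "(a * p + b) * p + c = (m * p + 1) * p \<longleftrightarrow> a = m \<and> b = 1 \<and> c = 0"
      using digit_append_eq_iff[of c p 0 "a * p + b" "m * p + 1"] digit_append_eq_iff[of b p 1 a m] z' assms
      by simp
    then show "e_gen p 4 4 (Suc ((m * p + 1) * p)) (label p z) = label p (only m (only 1 (only 0 (rot p))) z)"
      using e_gen_apply[of 4 4 d p 0 "(m * p + 1) * p" "(a * p + b) * p + c"] z'
      by (auto simp: label_def only_def)
  next
    have "(m * p + 1) * p + 0 < p * p * p"
      using m assms by (intro digit_append_less) auto
    then show "e_gen p 4 4 (Suc ((m * p + 1) * p)) n = n" if "n \<notin> {1..p ^ 4}" for n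
      using e_gen_outside[of 4 4 "(m * p + 1) * p" p n] that by (simp add: power3_eq_cube)
  qed
qed

section \<open>Facts about abstract groups\<close>

text \<open>
  If a prime \<open>q\<close> divides the order, Sylow's theorem with exponent \<open>1\<close> provides an element of
  order \<open>q\<close>, and then \<open>q\<close> divides \<open>p ^ n\<close>.
\<close>

lemma (in group) order_prime_power_if_exponent:
  assumes "prime p" and fin: "finite (carrier G)"
    and exponent: "\<And>x. x \<in> carrier G \<Longrightarrow> x [^] (p ^ n) = \<one>"
  shows "\<exists>k. order G = p ^ k"
proof -
  have "order G \<noteq> 0"
    using fin by (simp add: order_gt_0_iff_finite)
  have "q = p" if q: "prime q" "q dvd order G" for q
  proof -
    obtain m where m: "order G = q ^ 1 * m"
      using q by (auto simp: dvd_def)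
    then obtain H where H: "subgroup H G" "card H = q ^ 1"
      using sylow_thm[OF q(1) is_group m fin] by blast
    interpret H: subgroup H G
      by (rule H(1))
    have "H \<noteq> {\<one>}"
      using H(2) q(1) by (auto simp: prime_nat_iff)
    then obtain h where h: "h \<in> H" "h \<noteq> \<one>"
      using H.one_closed by blast
    have "h [^] q = \<one>"
      using group.pow_order_eq_1[OF subgroup_imp_group[OF H(1)], of h] h H(2)
      by (simp add: order_def flip: nat_pow_consistent)
    then have "ord h dvd q"
      using h H.mem_carrier pow_eq_id by blast
    then have "ord h = q"
      using q h ord_eq_1[of h] H.mem_carrier by (auto simp: prime_nat_iff)
    then have "q dvd p ^ n"
      using exponent[of h] h pow_eq_id[of h "p ^ n"] H.mem_carrier by auto
    then show ?thesis
      using q(1) assms(1) prime_dvd_power primes_dvd_imp_eq by blast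
  qed
  moreover obtain k m where m: "\<not> p dvd m" "order G = m * p ^ k"
    using prime_power_canonical[OF assms(1)] \<open>order G \<noteq> 0\<close> by (metis gr0I)
  ultimately have "m = 1"
    by (metis dvd_mult2 prime_factor_nat)
  then show ?thesis
    using m by auto
qed

lemma (in group) subgroup_cancel_left:
  assumes "subgroup H G" "a \<in> H" "a \<otimes> b \<in> H" "b \<in> carrier G"
  shows "b \<in> H"
proof -
  have "b = inv a \<otimes> (a \<otimes> b)"
    using assms by (simp add: m_assoc[symmetric] subgroup.mem_carrier)
  then show ?thesis
    using assms by (metis subgroup.m_closed subgroup.m_inv_closed)
qed

lemma (in group) subgroup_cancel_right:
  assumes "subgroup H G" "b \<in> H" "a \<otimes> b \<in> H" "a \<in> carrier G"
  shows "a \<in> H"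
proof -
  have "a = (a \<otimes> b) \<otimes> inv b"
    using assms by (simp add: m_assoc subgroup.mem_carrier)
  then show ?thesis
    using assms by (metis subgroup.m_closed subgroup.m_inv_closed)
qed

lemma (in group) generate_pair_eqI:
  assumes "x \<in> carrier G" "x' \<in> carrier G" "y \<in> carrier G"
    and "\<And>H. subgroup H G \<Longrightarrow> x \<in> H \<Longrightarrow> y \<in> H \<Longrightarrow> x' \<in> H"
    and "\<And>H. subgroup H G \<Longrightarrow> x' \<in> H \<Longrightarrow> y \<in> H \<Longrightarrow> x \<in> H"
  shows "generate G {x, y} = generate G {x', y}"
proof -
  have sub: "subgroup (generate G {x, y}) G" "subgroup (generate G {x', y}) G"
    using assms(1-3) by (auto intro: generate_is_subgroup)
  then have "x' \<in> generate G {x, y}" "x \<in> generate G {x', y}"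
    using assms(4,5) by (auto intro: generate.incl)
  then show ?thesis
    using sub by (intro equalityI generate_subgroup_incl) (auto intro: generate.incl)
qed

text \<open>
  The hypothesis identifies \<open>c\<close> with \<open>[x, y]\<close>, the inverse of \<open>[y, x]\<close>.
\<close>

lemma (in group) ord_comm_eq:
  assumes "x \<in> carrier G" "y \<in> carrier G" "c \<in> carrier G" and "y \<otimes> x \<otimes> c = x \<otimes> y"
  shows "ord (comm G y x) = ord c"
proof -
  have "comm G y x = inv (inv x \<otimes> inv y \<otimes> x \<otimes> y)"
    using assms(1,2) by (simp add: comm_def inv_mult_group m_assoc)
  also have "inv x \<otimes> inv y \<otimes> x \<otimes> y = inv x \<otimes> inv y \<otimes> (x \<otimes> y)"
    using assms(1,2) by (simp add: m_assoc)
  also have "\<dots> = inv (y \<otimes> x) \<otimes> (y \<otimes> x \<otimes> c)"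
    unfolding assms(4) using assms(1,2) by (simp add: inv_mult_group)
  also have "\<dots> = c"
  proof -
    have "inv w \<otimes> (w \<otimes> c) = c" if "w \<in> carrier G" for w
      using that assms(3) by (simp add: m_assoc[symmetric])
    then show ?thesis
      using assms(1,2) by blast
  qed
  finally show ?thesis
    using assms(3) by simp
qed

lemma (in group) ord_eq_prime_powerI:
  assumes "prime p" "x \<in> carrier G" "x [^] (p ^ Suc n) = \<one>" "x [^] (p ^ n) \<noteq> \<one>"
  shows "ord x = p ^ Suc n"
proof -
  obtain k where k: "k \<le> Suc n" "ord x = p ^ k"
    using assms pow_eq_id divides_primepow_nat by blast
  moreover have "\<not> k \<le> n"
    using assms(2,4) k pow_eq_id[of x "p ^ n"] by (auto intro: le_imp_power_dvd)
  ultimately show ?thesis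
    by (simp add: le_Suc_eq)
qed

lemma (in group) not_property_C:
  assumes "x \<in> carrier G" "x' \<in> carrier G" "y \<in> carrier G"
    and gen: "generate G {x, y} = generate G {x', y}"
    and ne: "ord (comm G y x) \<noteq> ord (comm G y x')"
  shows "\<not> property_C (subgroup_generated G {x, y})"
proof
  define K where "K = subgroup_generated G {x, y}"
  assume "property_C (subgroup_generated G {x, y})"
  then obtain n where n: "\<forall>a\<in>carrier K. \<forall>b\<in>carrier K. generate K {a, b} = carrier K \<longrightarrow>
      group.ord K (comm K a b) = n"
    unfolding property_C_def K_def by (rule exE)
  have car: "carrier K = generate G {x, y}"
    using assms(1,3) by (simp add: K_def carrier_subgroup_generated Int_absorb1)
  have sub: "subgroup (carrier K) G"
    unfolding K_def by (rule subgroup_subgroup_generated)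
  have "group K"
    unfolding K_def by simp
  have ord_K: "group.ord K a = ord a" for a
    using group.ord_def[OF \<open>group K\<close>, of a] by (simp add: ord_def K_def pow_subgroup_generated)
  have comm_K: "comm K a b = comm G a b" if "a \<in> carrier K" "b \<in> carrier K" for a b
    using that by (simp add: comm_def K_def)
  have "K = G\<lparr>carrier := carrier K\<rparr>"
    unfolding K_def subgroup_generated_def by simp
  then have gen_K: "generate K {a, b} = generate G {a, b}" if "a \<in> carrier K" "b \<in> carrier K" for a b
    using generate_consistent[of "{a, b}" "carrier K"] that sub by simp
  have "x \<in> carrier K" "y \<in> carrier K" "x' \<in> carrier K"
    using car gen by (auto intro: generate.incl)
  then have "ord (comm G y x) = n" "ord (comm G y x') = n"
    using n car gen by (auto simp: ord_K comm_K gen_K insert_commute)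
  then show False
    using ne by simp
qed

section \<open>Transfer to the symmetric group\<close>

text \<open>
  Kaloujnine's tableaux: the maps of four digits that rotate each digit by an amount depending on
  the digits before it.
\<close>

definition tableaux :: "nat \<Rightarrow> (digits \<Rightarrow> digits) set" where
  "tableaux p = wreath p (wreath p (wreath p (range (\<lambda>c. rot p ^^ c))))"

lemma split_at_0_wreath: "id \<in> W \<Longrightarrow> h \<in> W \<Longrightarrow> k \<in> W \<Longrightarrow> split_at_0 p h k \<in> wreath p W"
  unfolding split_at_0_def by (rule wreath_fiber) auto

lemma only_wreath: "id \<in> W \<Longrightarrow> h \<in> W \<Longrightarrow> only k h \<in> wreath p W"
  unfolding only_def by (rule wreath_fiber) auto

lemma ends_wreath: "id \<in> W \<Longrightarrow> a \<in> W \<Longrightarrow> b \<in> W \<Longrightarrow> ends p a b \<in> wreath p W"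
  unfolding ends_def by (rule wreath_fiber) auto

context
  fixes p :: nat
  assumes p: "2 \<le> p"
begin

definition "level1 = range (\<lambda>c. rot p ^^ c)"
definition "level2 = wreath p level1"
definition "level3 = wreath p level2"

lemma tableaux_eq: "tableaux p = wreath p level3"
  by (simp add: tableaux_def level1_def level2_def level3_def)

lemma torsion_level1: "torsion_monoid p {..<p} level1"
  unfolding level1_def by (rule torsion_monoid_rot[OF p])

lemma torsion_level2: "torsion_monoid (p * p) ({..<p} \<times> {..<p}) level2"
  unfolding level2_def by (rule torsion_monoid_wreath[OF torsion_level1 p])

lemma torsion_level3: "torsion_monoid (p * (p * p)) ({..<p} \<times> {..<p} \<times> {..<p}) level3"
  unfolding level3_def by (rule torsion_monoid_wreath[OF torsion_level2 p])

lemma torsion_tableaux: "torsion_monoid (p ^ 4) (digits p) (tableaux p)"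
  unfolding tableaux_eq using torsion_monoid_wreath[OF torsion_level3 p] by (simp add: power4_eq_xxxx mult_ac)

lemma id_in_levels: "id \<in> level1" "id \<in> level2" "id \<in> level3"
  using torsion_level1 torsion_level2 torsion_level3 by (simp_all add: torsion_monoid_def)

lemma level_comp: "f \<in> level1 \<Longrightarrow> g \<in> level1 \<Longrightarrow> f \<circ> g \<in> level1"
  "f' \<in> level2 \<Longrightarrow> g' \<in> level2 \<Longrightarrow> f' \<circ> g' \<in> level2"
  "f'' \<in> level3 \<Longrightarrow> g'' \<in> level3 \<Longrightarrow> f'' \<circ> g'' \<in> level3"
  using torsion_level1 torsion_level2 torsion_level3 by (simp_all add: torsion_monoid_def)

lemma tableaux_comp: "f \<in> tableaux p \<Longrightarrow> g \<in> tableaux p \<Longrightarrow> f \<circ> g \<in> tableaux p"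
  using torsion_tableaux by (simp add: torsion_monoid_def)

lemma maps_in_level1: "rot p \<in> level1" "rot p ^^ (p - 1) \<in> level1"
  unfolding level1_def by (auto intro: range_eqI[of _ _ 1])

lemma maps_in_level2: "nudge p \<in> level2" "unnudge p \<in> level2" "turn p \<in> level2" "nudge_comm p \<in> level2"
  unfolding level2_def nudge_def unnudge_def nudge_comm_def
  by (intro only_wreath wreath_turn ends_wreath id_in_levels maps_in_level1)+

lemma maps_in_level3: "turn p \<in> level3" "h \<in> level2 \<Longrightarrow> every p h \<in> level3" "h \<in> level2 \<Longrightarrow> only k h \<in> level3"
  unfolding level3_def
  by (intro wreath_turn split_at_0_wreath only_wreath id_in_levels; assumption)+

lemma elements_in_level3: "slot p k \<in> level3" "mark p \<in> level3" "shift p \<in> level3"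
  unfolding slot_def mark_def shift_def by (intro level_comp maps_in_level3 maps_in_level2)+

lemma maps_in_tableaux: "turn p \<in> tableaux p" "h \<in> level3 \<Longrightarrow> only k h \<in> tableaux p"
  "h \<in> level3 \<Longrightarrow> h' \<in> level3 \<Longrightarrow> split_at_0 p h h' \<in> tableaux p"
  "h \<in> level3 \<Longrightarrow> h' \<in> level3 \<Longrightarrow> ends p h h' \<in> tableaux p"
  unfolding tableaux_eq
  by (intro wreath_turn split_at_0_wreath only_wreath ends_wreath id_in_levels; assumption)+

lemma elements_in_tableaux: "x_elem p k \<in> tableaux p" "y_elem p \<in> tableaux p" "y_cleared_at_0 p \<in> tableaux p" "y_cleared p \<in> tableaux p"
  "xy_comm p k \<in> tableaux p"
  unfolding x_elem_def y_elem_def y_cleared_at_0_def[OF p] y_cleared_def[OF p] xy_comm_def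
  using torsion_monoid_funpow[OF torsion_level3 maps_in_level3(1)]
  by (auto intro!: maps_in_tableaux tableaux_comp level_comp maps_in_level3 elements_in_level3 maps_in_level2)

abbreviation (input) "G \<equiv> sym_group (p ^ 4)"

interpretation G: group G
  by (rule sym_group_is_group)

lemma tableaux_digits: "f \<in> tableaux p \<Longrightarrow> f ` digits p \<subseteq> digits p"
  using torsion_tableaux by (simp add: torsion_monoid_def)

lemma relabel_carrier:
  assumes f: "f \<in> tableaux p"
  shows "relabel p f \<in> carrier G"
proof -
  have "f ^^ (p ^ 4) = id"
    using torsion_tableaux f by (simp add: torsion_monoid_def)
  then have "relabel p f ^^ (p ^ 4) = id"
    using relabel_funpow[OF tableaux_digits[OF f]] by (simp add: relabel_id)
  moreover obtain n where "p ^ 4 = Suc n"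
    using p by (metis gr0_implies_Suc not_numeral_le_zero zero_less_power not_gr_zero)
  ultimately have "relabel p f \<circ> relabel p f ^^ n = id" "relabel p f ^^ n \<circ> relabel p f = id"
    by (metis funpow.simps(2), metis funpow_Suc_right)
  then have "bij (relabel p f)"
    using o_bij by blast
  then show ?thesis
    unfolding sym_group_carrier permutes_def using relabel_outside bij_iff[of "relabel p f"] by blast
qed

lemma relabel_mult: "g \<in> tableaux p \<Longrightarrow> relabel p f \<otimes>\<^bsub>G\<^esub> relabel p g = relabel p (f \<circ> g)"
  using relabel_comp[OF tableaux_digits] by (simp add: sym_group_mult)

lemma relabel_pow: "f \<in> tableaux p \<Longrightarrow> relabel p f [^]\<^bsub>G\<^esub> n = relabel p (f ^^ n)"
proof (induction n)
  case 0
  show ?case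
    by (simp add: sym_group_one relabel_id[unfolded id_def] id_def)
next
  case (Suc n)
  have "relabel p f [^]\<^bsub>G\<^esub> Suc n = relabel p (f ^^ n) \<otimes>\<^bsub>G\<^esub> relabel p f"
    using Suc by simp
  then show ?case
    unfolding relabel_mult[OF Suc.prems] by (simp only: funpow_Suc_right)
qed

lemma relabel_ne_one:
  assumes "z \<in> digits p" "f z \<in> digits p" "f z \<noteq> z"
  shows "relabel p f \<noteq> \<one>\<^bsub>G\<^esub>"
proof
  assume "relabel p f = \<one>\<^bsub>G\<^esub>"
  then have "label p (f z) = label p z"
    using relabel_label[OF assms(1), of f] by (simp add: sym_group_one)
  then show False
    using assms bij_betw_label[of p] by (metis bij_betw_def inj_onD)
qed

abbreviation (input) "X k \<equiv> relabel p (x_elem p k)"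
abbreviation (input) "Y \<equiv> relabel p (y_elem p)"

text \<open>
  With $R = x_0^p$, $S = y^p$ and $Z = S^{-1}y$, the element $M = Z R Z^{-1}$ satisfies
  $x_1 R = x_0 M$.
\<close>

lemma x1_in_subgroup:
  assumes H: "subgroup H G" and X: "X 0 \<in> H" and Y: "Y \<in> H"
  shows "X 1 \<in> H"
proof -
  interpret H: subgroup H G by (rule H)
  define R where "R = relabel p (every p (slot p 0))"
  define S where "S = relabel p (split_at_0 p (every p (nudge p)) id)"
  define Z where "Z = relabel p (y_cleared_at_0 p)"
  define M where "M = relabel p (split_at_0 p (slot p 1) (slot p 0))"
  note mem = maps_in_tableaux maps_in_level3 elements_in_level3 maps_in_level2 elements_in_tableaux id_in_levels
  note car = relabel_carrier[OF elements_in_tableaux(1)] relabel_carrier[OF elements_in_tableaux(3)]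
  have M_car: "M \<in> carrier G"
    unfolding M_def by (intro relabel_carrier mem)
  have pow: "A [^]\<^bsub>G\<^esub> n \<in> H" if "A \<in> H" for A and n :: nat
    using that by (induction n) auto
  have R: "R \<in> H"
    using pow[OF X, of p] unfolding relabel_pow[OF elements_in_tableaux(1)] x_elem_pow[OF p] R_def .
  have S: "S \<in> H"
    using pow[OF Y, of p] unfolding relabel_pow[OF elements_in_tableaux(2)] y_elem_pow[OF p] S_def .
  have "S \<otimes>\<^bsub>G\<^esub> Z = Y"
    unfolding S_def Z_def relabel_mult[OF elements_in_tableaux(3)] y_cleared_at_0_y_elem[OF p] ..
  then have Z: "Z \<in> H"
    using G.subgroup_cancel_left[OF H S] Y car unfolding Z_def by metis
  have "M \<otimes>\<^bsub>G\<^esub> Z = Z \<otimes>\<^bsub>G\<^esub> R"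
    unfolding M_def Z_def R_def using relabel_mult mem y_cleared_at_0_slot[OF p] by metis
  then have M: "M \<in> H"
    using G.subgroup_cancel_right[OF H Z _ M_car] Z R by simp
  have "X 1 \<otimes>\<^bsub>G\<^esub> R = X 0 \<otimes>\<^bsub>G\<^esub> M"
    unfolding R_def M_def using relabel_mult mem x_elem_every[OF p] by metis
  then show ?thesis
    using G.subgroup_cancel_right[OF H R _ car(1)] X M by simp
qed

text \<open>
  With $R = x_1^p$, $S = y^p$, $T = R^{-1}(x_1 S)^p$ and $Z = T^{-1}y$, the element
  $M = Z^{-1} R Z$ satisfies $x_0 R = x_1 M$.
\<close>

lemma x0_in_subgroup:
  assumes H: "subgroup H G" and X: "X 1 \<in> H" and Y: "Y \<in> H"
  shows "X 0 \<in> H"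
proof -
  interpret H: subgroup H G by (rule H)
  define R where "R = relabel p (every p (slot p 1))"
  define S where "S = relabel p (split_at_0 p (every p (nudge p)) id)"
  define T where "T = relabel p (every p (every p (nudge p)))"
  define Z where "Z = relabel p (y_cleared p)"
  define M where "M = relabel p (split_at_0 p (slot p 0) (slot p 1))"
  note mem = maps_in_tableaux maps_in_level3 elements_in_level3 maps_in_level2 elements_in_tableaux id_in_levels
  have car: "X 0 \<in> carrier G" "Z \<in> carrier G" "M \<in> carrier G" "T \<in> carrier G"
    unfolding Z_def M_def T_def by (intro relabel_carrier mem)+
  have pow: "A [^]\<^bsub>G\<^esub> n \<in> H" if "A \<in> H" for A and n :: nat
    using that by (induction n) auto
  have R: "R \<in> H"
    using pow[OF X, of p] unfolding relabel_pow[OF elements_in_tableaux(1)] x_elem_pow[OF p] R_def .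
  have S: "S \<in> H"
    using pow[OF Y, of p] unfolding relabel_pow[OF elements_in_tableaux(2)] y_elem_pow[OF p] S_def .
  have "(X 1 \<otimes>\<^bsub>G\<^esub> S) [^]\<^bsub>G\<^esub> p = R \<otimes>\<^bsub>G\<^esub> T"
    unfolding R_def T_def S_def
    by (simp only: relabel_mult relabel_pow mem tableaux_comp x_elem_y_elem_pow[OF p])
  then have "R \<otimes>\<^bsub>G\<^esub> T \<in> H"
    using pow[of "X 1 \<otimes>\<^bsub>G\<^esub> S" p] X S by simp
  then have T: "T \<in> H"
    using G.subgroup_cancel_left[OF H R _ car(4)] by simp
  have "T \<otimes>\<^bsub>G\<^esub> Z = Y"
    unfolding T_def Z_def relabel_mult[OF elements_in_tableaux(4)] y_cleared_y_elem[OF p] ..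
  then have Z: "Z \<in> H"
    using G.subgroup_cancel_left[OF H T _ car(2)] Y by simp
  have "Z \<otimes>\<^bsub>G\<^esub> M = R \<otimes>\<^bsub>G\<^esub> Z"
    unfolding M_def Z_def R_def using relabel_mult mem y_cleared_slot[OF p] by metis
  then have M: "M \<in> H"
    using G.subgroup_cancel_left[OF H Z _ car(3)] Z R by simp
  have "X 0 \<otimes>\<^bsub>G\<^esub> R = X 1 \<otimes>\<^bsub>G\<^esub> M"
    unfolding R_def M_def using relabel_mult mem x_elem_every[OF p] by metis
  then show ?thesis
    using G.subgroup_cancel_right[OF H R _ car(1)] X M by simp
qed

lemma ord_comm_y_x:
  assumes "k \<le> 1"
  shows "G.ord (comm G Y (X k)) = G.ord (relabel p (xy_comm p k))"
proof (rule G.ord_comm_eq)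
  show "Y \<otimes>\<^bsub>G\<^esub> X k \<otimes>\<^bsub>G\<^esub> relabel p (xy_comm p k) = X k \<otimes>\<^bsub>G\<^esub> Y"
    using xy_comm_eq[OF p assms] by (simp only: relabel_mult elements_in_tableaux)
qed (intro relabel_carrier elements_in_tableaux)+

lemma ord_comm_y_x0:
  assumes "prime p"
  shows "G.ord (comm G Y (X 0)) = p"
proof -
  have "relabel p (xy_comm p 0) [^]\<^bsub>G\<^esub> (p ^ Suc 0) = \<one>\<^bsub>G\<^esub>"
    using xy_comm0_pow[OF p] by (simp add: relabel_pow elements_in_tableaux relabel_id sym_group_one)
  moreover have "relabel p (xy_comm p 0) \<noteq> \<one>\<^bsub>G\<^esub>"
    by (rule relabel_ne_one[of "(0, 0, 0, 0)"]) (use p xy_comm0_moves[OF p] in auto)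
  then have "relabel p (xy_comm p 0) [^]\<^bsub>G\<^esub> (p ^ 0) \<noteq> \<one>\<^bsub>G\<^esub>"
    using relabel_carrier[OF elements_in_tableaux(5)] by simp
  ultimately have "G.ord (relabel p (xy_comm p 0)) = p ^ Suc 0"
    by (intro G.ord_eq_prime_powerI[OF assms] relabel_carrier elements_in_tableaux)
  then show ?thesis
    by (simp add: ord_comm_y_x)
qed

lemma ord_comm_y_x1:
  assumes "prime p"
  shows "G.ord (comm G Y (X 1)) = p ^ 2"
proof -
  have "relabel p (xy_comm p 1) [^]\<^bsub>G\<^esub> (p ^ Suc 1) = \<one>\<^bsub>G\<^esub>"
    unfolding relabel_pow[OF elements_in_tableaux(5)] using xy_comm1_pow2[OF p]
    by (simp only: Suc_1 relabel_id sym_group_one)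
  moreover have "relabel p (xy_comm p 1 ^^ p) \<noteq> \<one>\<^bsub>G\<^esub>"
    by (rule relabel_ne_one[of "(0, 0, 0, 0)"]) (use p xy_comm1_pow_moves[OF p] in auto)
  then have "relabel p (xy_comm p 1) [^]\<^bsub>G\<^esub> (p ^ 1) \<noteq> \<one>\<^bsub>G\<^esub>"
    unfolding relabel_pow[OF elements_in_tableaux(5)] by (simp only: power_one_right not_False_eq_True)
  ultimately have "G.ord (relabel p (xy_comm p 1)) = p ^ Suc 1"
    by (intro G.ord_eq_prime_powerI[OF assms] relabel_carrier elements_in_tableaux)
  then show ?thesis
    by (simp only: ord_comm_y_x order_refl Suc_1)
qed

lemma e_gen_in_P_syl: "1 \<le> i \<Longrightarrow> i \<le> 4 \<Longrightarrow> J < p ^ (i - 1) \<Longrightarrow> e_gen p 4 i (Suc J) \<in> P_syl p 4"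
  unfolding P_syl_def by (rule generate.incl) force

lemma P_syl_comp: "f \<in> P_syl p 4 \<Longrightarrow> g \<in> P_syl p 4 \<Longrightarrow> f \<circ> g \<in> P_syl p 4"
  unfolding P_syl_def using generate.eng[of f G _ g] by (simp add: sym_group_mult)

lemma turns_in_P_syl:
  "relabel p (turn p) \<in> P_syl p 4"
  "relabel p (only 0 (turn p)) \<in> P_syl p 4"
  "k \<le> 1 \<Longrightarrow> relabel p (only 0 (slot p k)) \<in> P_syl p 4"
  "m < p \<Longrightarrow> relabel p (only m (mark p)) \<in> P_syl p 4"
proof -
  show "relabel p (turn p) \<in> P_syl p 4"
    using e_gen_in_P_syl[of 1 0] e_gen_relabel(1)[OF p] by simp
  show "relabel p (only 0 (turn p)) \<in> P_syl p 4"
    using e_gen_in_P_syl[of 2 0] e_gen_relabel(2)[OF p] p by simp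
  show "relabel p (only 0 (slot p k)) \<in> P_syl p 4" if "k \<le> 1"
  proof -
    have "k < p"
      using that p by simp
    moreover have "k < p * p"
      using \<open>k < p\<close> le_square by (rule less_le_trans)
    ultimately show ?thesis
      using e_gen_in_P_syl[of 3 k] e_gen_relabel(3)[OF p, of k] by (simp add: slot_def power2_eq_square)
  qed
  show "relabel p (only m (mark p)) \<in> P_syl p 4" if "m < p"
  proof -
    have "(m * p + 1) * p + 0 < p * p * p"
      using that p by (intro digit_append_less) auto
    then show ?thesis
      using e_gen_in_P_syl[of 4 "(m * p + 1) * p"] e_gen_relabel(4)[OF p that]
      by (simp add: power3_eq_cube mark_def nudge_def)
  qed
qed

lemma x_in_P_syl:
  assumes "k \<le> 1"
  shows "X k \<in> P_syl p 4"
proof -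
  have "X k = relabel p (turn p) \<circ> relabel p (only 0 (slot p k))"
    unfolding x_elem_def using relabel_comp[OF tableaux_digits] maps_in_tableaux(2) elements_in_level3(1) by metis
  then show ?thesis
    using P_syl_comp turns_in_P_syl(1,3) assms by simp
qed

text \<open>
  The part of $y$ that changes $d_4$ is the product of the generators $e_{4,j}$ over all
  prefixes \<open>m, 1, 0\<close>; it is built up one value of \<open>m\<close> at a time.
\<close>

lemma y_in_P_syl: "Y \<in> P_syl p 4"
proof -
  define V where "V m = fiber (\<lambda>d. if d < m then mark p else id)" for m :: nat
  have V: "V m \<in> tableaux p" for m
    unfolding V_def tableaux_eq using elements_in_level3(2) id_in_levels(3) by (intro wreath_fiber) simp
  have "relabel p (V m) \<in> P_syl p 4" if "m \<le> p" for m
    using that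
  proof (induction m)
    case 0
    have "relabel p (V 0) = id"
      by (simp add: V_def fiber_id relabel_id)
    then show ?case
      using generate.one[of G] by (simp only: P_syl_def sym_group_one)
  next
    case (Suc m)
    have "V (Suc m) = only m (mark p) \<circ> V m"
      unfolding V_def only_def fiber_comp by (rule arg_cong[of _ _ fiber]) auto
    then have step: "relabel p (V (Suc m)) = relabel p (only m (mark p)) \<circ> relabel p (V m)"
      using relabel_comp[OF tableaux_digits[OF V]] by simp
    show ?case
      unfolding step using Suc by (intro P_syl_comp turns_in_P_syl(4)) simp_all
  qed
  moreover have "y_elem p = V p \<circ> only 0 (turn p)"
    unfolding V_def only_def y_elem_def split_at_0_def fiber_comp shift_def
    using p by (intro arg_cong[of _ _ fiber]) auto
  then have "Y = relabel p (V p) \<circ> relabel p (only 0 (turn p))"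
    using relabel_comp[OF tableaux_digits[OF maps_in_tableaux(2)[OF maps_in_level3(1)]]] by simp
  ultimately show ?thesis
    using P_syl_comp turns_in_P_syl(2) by simp
qed

text \<open>
  Since the tableaux have a common exponent, inverses are powers, and the transported tableaux
  already form a subgroup.
\<close>

lemma generate_tableaux:
  assumes "f \<in> generate G (relabel p ` tableaux p)"
  shows "f \<in> relabel p ` tableaux p"
  using assms
proof (induction rule: generate.induct)
  case one
  show ?case
    using torsion_tableaux relabel_id by (metis imageI sym_group_one torsion_monoid_def)
next
  case (incl h)
  then show ?case .
next
  case (inv h)
  then obtain f where f: "f \<in> tableaux p" "h = relabel p f"
    by blast
  have "relabel p (f ^^ (p ^ 4 - 1)) \<otimes>\<^bsub>G\<^esub> relabel p f = relabel p (f ^^ (p ^ 4 - 1) \<circ> f)"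
    by (rule relabel_mult[OF f(1)])
  also have "f ^^ (p ^ 4 - 1) \<circ> f = f ^^ (p ^ 4)"
    using p by (metis Suc_diff_1 funpow_Suc_right less_le_trans zero_less_numeral zero_less_power)
  also have "\<dots> = id"
    using torsion_tableaux f by (simp add: torsion_monoid_def)
  finally have "inv\<^bsub>G\<^esub> h = relabel p (f ^^ (p ^ 4 - 1))"
    using G.inv_equality f relabel_carrier torsion_monoid_funpow[OF torsion_tableaux]
    by (metis relabel_id sym_group_one)
  then show ?case
    using torsion_monoid_funpow[OF torsion_tableaux f(1)] by simp
next
  case (eng h1 h2)
  then obtain f1 f2 where "f1 \<in> tableaux p" "h1 = relabel p f1" "f2 \<in> tableaux p" "h2 = relabel p f2"
    by blast
  then show ?case
    using relabel_mult tableaux_comp by (metis imageI)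
qed

lemma order_generated:
  assumes "prime p"
  shows "\<exists>k. order (subgroup_generated G {X 1, Y}) = p ^ k"
proof (rule group.order_prime_power_if_exponent[OF _ assms])
  show "group (subgroup_generated G {X 1, Y})"
    by simp
  have "finite (carrier G)"
    by (simp add: sym_group_def finite_permutations)
  then show "finite (carrier (subgroup_generated G {X 1, Y}))"
    using G.carrier_subgroup_generated_subset finite_subset by blast
  fix f assume "f \<in> carrier (subgroup_generated G {X 1, Y})"
  then have "f \<in> generate G (relabel p ` tableaux p)"
    unfolding carrier_subgroup_generated
    using G.mono_generate[of "carrier G \<inter> {X 1, Y}" "relabel p ` tableaux p"] elements_in_tableaux by blast
  then obtain g where g: "g \<in> tableaux p" "f = relabel p g"
    using generate_tableaux by blast
  have "g ^^ (p ^ 4) = id"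
    using torsion_tableaux g by (simp add: torsion_monoid_def)
  then show "f [^]\<^bsub>subgroup_generated G {X 1, Y}\<^esub> (p ^ 4) = \<one>\<^bsub>subgroup_generated G {X 1, Y}\<^esub>"
    using g by (simp add: pow_subgroup_generated relabel_pow relabel_id sym_group_one)
qed

end

section \<open>The pair of commutators\<close>

theorem lemma3p34:
  fixes p :: nat
  assumes "prime p"
  shows "\<exists>x\<in>P_syl p 4. \<exists>x'\<in>P_syl p 4. \<exists>y\<in>P_syl p 4.
    generate (sym_group (p ^ 4)) {x, y} = generate (sym_group (p ^ 4)) {x', y} \<and>
    group.ord (sym_group (p ^ 4)) (comm (sym_group (p ^ 4)) y x') = p \<and>
    p \<noteq> p ^ 2 \<and>
    group.ord (sym_group (p ^ 4)) (comm (sym_group (p ^ 4)) y x) = p ^ 2 \<and>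
    (\<exists>k. order (subgroup_generated (sym_group (p ^ 4)) {x, y}) = p ^ k) \<and>
    \<not> property_C (subgroup_generated (sym_group (p ^ 4)) {x, y})"
proof -
  interpret G: group "sym_group (p ^ 4)"
    by (rule sym_group_is_group)
  have p: "2 \<le> p"
    using assms by (rule prime_ge_2_nat)
  let ?x = "relabel p (x_elem p 1)" and ?x' = "relabel p (x_elem p 0)" and ?y = "relabel p (y_elem p)"
  have car: "?x \<in> carrier (sym_group (p ^ 4))" "?x' \<in> carrier (sym_group (p ^ 4))"
    "?y \<in> carrier (sym_group (p ^ 4))"
    by (intro relabel_carrier elements_in_tableaux p)+
  have gen: "generate (sym_group (p ^ 4)) {?x, ?y} = generate (sym_group (p ^ 4)) {?x', ?y}"
    using car x0_in_subgroup[OF p] x1_in_subgroup[OF p] by (intro G.generate_pair_eqI)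
  have ne: "p \<noteq> p ^ 2"
    using p by (simp add: power2_eq_square)
  have "\<not> property_C (subgroup_generated (sym_group (p ^ 4)) {?x, ?y})"
    using ne by (intro G.not_property_C[OF car gen]) (simp add: ord_comm_y_x0 ord_comm_y_x1 p assms del: One_nat_def)
  then show ?thesis
    using gen ne ord_comm_y_x0[OF p assms] ord_comm_y_x1[OF p assms] order_generated[OF p assms]
      x_in_P_syl[OF p, of 1] x_in_P_syl[OF p, of 0] y_in_P_syl[OF p]
    by (intro bexI[of _ ?x] bexI[of _ ?x'] bexI[of _ ?y] conjI) auto
qed

end
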